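(* Let $\Theta$ be a first-order signature. For every set $\Gamma\cup\{\varphi\}\subseteq For(\Theta)$: if $\Gamma\vdash_{\mathbf{QmbC}}\varphi$, then $\Gamma\models_{\mathbf{QmbC}}\varphi$ (semantical consequence with respect to first-order swap structures).
   Context: **Language.** $Var$ is a denumerable set of individual variables. A first-order signature $\Theta$ consists of a set $\mathcal C$ of individual constants and, for each $n\ge 1$, sets $\mathcal F_n$ and $\mathcal P_n$ of function and predicate symbols of arity $n$ (with at least one predicate symbol). Formulas are built with binary connectives $\wedge,\vee,\to$, unary connectives $\neg,\circ$, and quantifiers $\forall,\exists$. $Ter(\Theta)$, $CTer(\Theta)$, $For(\Theta)$, $Sen(\Theta)$ are the sets of terms, closed terms, formulas and sentences. $\varphi[x/t]$ is the result of replacing every free occurrence of $x$ in $\varphi$ by $t$. Two formulas are *variants* if one is obtained from the other by addition or deletion of void quantifiers, or by renaming bound variables (keeping the same free variables in the same places). **Calculus QmbC** (Hilbert calculus over $For(\Theta)$). Axiom schemas: (A1) $\alpha\to(\beta\to\alpha)$; (A2) $(\alpha\to(\beta\to\gamma))\to((\alpha\to\beta)\to(\alpha\to\gamma))$; (A3) $\alpha\to(\beta\to(\alpha\wedge\beta))$; (A4) $(\alpha\wedge\beta)\to\alpha$; (A5) $(\alpha\wedge\beta)\to\beta$; (A6) $\alpha\to(\alpha\vee\beta)$; (A7) $\beta\to(\alpha\vee\beta)$; (A8) $(\alpha\to\gamma)\to((\beta\to\gamma)\to((\alpha\vee\beta)\to\gamma))$; (A9) $\alpha\vee(\alpha\to\beta)$;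 (A10) $\alpha\vee\neg\alpha$; (A11) $\circ\alpha\to(\alpha\to(\neg\alpha\to\beta))$; (Ax12) $\varphi[x/t]\to\exists x\varphi$ if $t$ is free for $x$ in $\varphi$; (Ax13) $\forall x\varphi\to\varphi[x/t]$ if $t$ is free for $x$ in $\varphi$; (Ax14) $\alpha\to\beta$ whenever $\alpha$ is a variant of $\beta$. Rules: (MP) from $\alpha$, $\alpha\to\beta$ infer $\beta$; ($\exists$-In) from $\varphi\to\psi$ infer $\exists x\varphi\to\psi$ if $x$ is not free in $\psi$; ($\forall$-In) from $\varphi\to\psi$ infer $\varphi\to\forall x\psi$ if $x$ is not free in $\varphi$. $\Gamma\vdash_{\mathbf{QmbC}}\varphi$ means there is a finite derivation of $\varphi$ whose steps are axiom instances, members of $\Gamma$, or follow from earlier steps by a rule. **Swap structures.** For a Boolean algebra $\mathcal A$ with domain $A$, let $B_{\mathcal A}=\{x\in A^3: x_1\vee x_2=1,\ x_1\wedge x_2\wedge x_3=0\}$, where $x_i=\pi_i(x)$ is the $i$-th coordinate. A *swap structure for mbC over $\mathcal A$* is a multialgebra $\mathcal B=(B,\tilde\wedge,\tilde\vee,\tilde\to,\tilde\neg,\tilde\circ)$ with $\emptyset\neq B\subseteq B_{\mathcal A}$ (write $|\mathcal B|=B$) such that for all $x,y\in B$: $\emptyset\ne x\tilde\# y\subseteq\{z\in B: z_1=x_1\# y_1\}$ for $\#\in\{\wedge,\vee,\to\}$; $\emptyset\neq\tilde\neg x\subseteq\{z\in B: z_1=x_2\}$; $\emptyset\ne\tilde\circ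 x\subseteq\{z\in B: z_1=x_3\}$. Its Nmatrix is $\mathcal M(\mathcal B)=(\mathcal B,D)$ with $D=\{x\in B: x_1=1\}$. **Structures and valuations.** Let $\mathcal B$ be a swap structure for mbC over a *complete* Boolean algebra. A structure $\mathfrak A=\langle U,I_{\mathfrak A}\rangle$ over $\mathcal M(\mathcal B)$ and $\Theta$ has a nonempty domain $U$ and assigns $c^{\mathfrak A}\in U$ to constants, $f^{\mathfrak A}:U^n\to U$ to $n$-ary function symbols, and $P^{\mathfrak A}:U^n\to|\mathcal B|$ to $n$-ary predicate symbols. $\Theta_U$ is $\Theta$ plus a new constant $\bar a$ for each $a\in U$; $\widehat{\mathfrak A}$ extends $\mathfrak A$ by interpreting $\bar a$ as $a$. An assignment is a map $\mu:Var\to U$; $[\![t]\!]^{\widehat{\mathfrak A}}_\mu\in U$ is the usual value of a term $t$ (the subscript is omitted for closed terms); $\widehat\mu(s)$ is obtained from a term or formula $s$ over $\Theta_U$ by replacing each free variable $x$ by $\overline{\mu(x)}$; $\mu^x_a$ is $\mu$ changed to take value $a$ at $x$. A *QmbC-valuation* over $\mathfrak A$ and $\mathcal M(\mathcal B)$ is a map $v:Sen(\Theta_U)\to|\mathcal B|$ such that: (i) $v(P(t_1,\dots,t_n))=P^{\mathfrak A}([\![t_1]\!]^{\widehat{\mathfrak A}},\dots,[\![t_n]\!]^{\widehat{\mathfrak A}})$; (ii) $v(\#\varphi)\in\tilde\# v(\varphi)$ for $\#\in\{\neg,\circ\}$; (iii) $v(\varphi\#\psi)\in v(\varphi)\tilde\#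 v(\psi)$ for $\#\in\{\wedge,\vee,\to\}$; (iv) $(v(\forall x\varphi))_1=\bigwedge_{a\in U}(v(\varphi[x/\bar a]))_1$; (v) $(v(\exists x\varphi))_1=\bigvee_{a\in U}(v(\varphi[x/\bar a]))_1$; (vi) whenever $t$ is free for $z$ in $\varphi$ and $\psi$, $\mu$ is an assignment and $b=[\![t]\!]^{\widehat{\mathfrak A}}_\mu$: (vi.1) if $v(\widehat\mu(\varphi[z/t]))=v(\widehat\mu(\varphi[z/\bar b]))$ then $v(\widehat\mu((\#\varphi)[z/t]))=v(\widehat\mu((\#\varphi)[z/\bar b]))$ for $\#\in\{\neg,\circ\}$; (vi.2) if $v(\widehat\mu(\varphi[z/t]))=v(\widehat\mu(\varphi[z/\bar b]))$ and $v(\widehat\mu(\psi[z/t]))=v(\widehat\mu(\psi[z/\bar b]))$ then $v(\widehat\mu((\varphi\#\psi)[z/t]))=v(\widehat\mu((\varphi\#\psi)[z/\bar b]))$ for $\#\in\{\wedge,\vee,\to\}$; (vi.3) if $x\ne z$, $x$ does not occur in $t$, and $v(\widehat{\mu^x_a}(\varphi[z/t]))=v(\widehat{\mu^x_a}(\varphi[z/\bar b]))$ for every $a\in U$, then $v(\widehat\mu((Qx\varphi)[z/t]))=v(\widehat\mu((Qx\varphi)[z/\bar b]))$ for $Q\in\{\forall,\exists\}$; (vii) $v(\varphi)=v(\varphi')$ if $\varphi,\varphi'$ are variants. Put $v_\mu(\varphi)=v(\widehat\mu(\varphi))$ for $\varphi\in For(\Theta_U)$. **Consequence.** $\Gamma\models_{(\mathfrak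 A,\mathcal M(\mathcal B))}\varphi$ iff for every QmbC-valuation $v$ over $\mathfrak A$ and $\mathcal M(\mathcal B)$: if $v_\mu(\gamma)\in D$ for all $\gamma\in\Gamma$ and all assignments $\mu$, then $v_\mu(\varphi)\in D$ for all $\mu$. $\Gamma\models_{\mathbf{QmbC}}\varphi$ iff $\Gamma\models_{(\mathfrak A,\mathcal M(\mathcal B))}\varphi$ for every swap structure $\mathcal B$ for mbC over a complete Boolean algebra and every structure $\mathfrak A$ over $\mathcal M(\mathcal B)$ and $\Theta$. *)

theory Defs
  imports Main
begin

unbundle lattice_syntax

section \<open>First-order language\<close>

type_synonym var = nat

datatype ('c, 'f) tm = Var var | Cst 'c | App 'f "('c, 'f) tm list"

datatype ('c, 'f, 'p) fm =
    Atom 'p "('c, 'f) tm list"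
  | And "('c, 'f, 'p) fm" "('c, 'f, 'p) fm"
  | Or "('c, 'f, 'p) fm" "('c, 'f, 'p) fm"
  | Imp "('c, 'f, 'p) fm" "('c, 'f, 'p) fm"
  | Neg "('c, 'f, 'p) fm"
  | Circ "('c, 'f, 'p) fm"
  | Forall var "('c, 'f, 'p) fm"
  | Exists var "('c, 'f, 'p) fm"

text \<open>The sets of symbols are explicit, rather than being whole types, because the set of
  constants and the sets of function symbols may be empty.\<close>

record ('c, 'f, 'p) signature =
  csyms :: "'c set"
  fsyms :: "nat \<Rightarrow> 'f set"
  psyms :: "nat \<Rightarrow> 'p set"

text \<open>Symbols are sorted by arities at least 1, hence nothing has arity 0.\<close>

definition fo_signature :: "('c, 'f, 'p) signature \<Rightarrow> bool" where
  "fo_signature \<Theta> \<longleftrightarrow> fsyms \<Theta> 0 = {} \<and> psyms \<Theta> 0 = {} \<and> (\<exists>n. psyms \<Theta> n \<noteq> {})"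

fun wf_tm :: "('c, 'f, 'p) signature \<Rightarrow> ('c, 'f) tm \<Rightarrow> bool" where
  "wf_tm \<Theta> (Var x) \<longleftrightarrow> True"
| "wf_tm \<Theta> (Cst c) \<longleftrightarrow> c \<in> csyms \<Theta>"
| "wf_tm \<Theta> (App f ts) \<longleftrightarrow> f \<in> fsyms \<Theta> (length ts) \<and> (\<forall>t\<in>set ts. wf_tm \<Theta> t)"

fun wf_fm :: "('c, 'f, 'p) signature \<Rightarrow> ('c, 'f, 'p) fm \<Rightarrow> bool" where
  "wf_fm \<Theta> (Atom p ts) \<longleftrightarrow> p \<in> psyms \<Theta> (length ts) \<and> (\<forall>t\<in>set ts. wf_tm \<Theta> t)"
| "wf_fm \<Theta> (And \<phi> \<psi>) \<longleftrightarrow> wf_fm \<Theta> \<phi> \<and> wf_fm \<Theta> \<psi>"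
| "wf_fm \<Theta> (Or \<phi> \<psi>) \<longleftrightarrow> wf_fm \<Theta> \<phi> \<and> wf_fm \<Theta> \<psi>"
| "wf_fm \<Theta> (Imp \<phi> \<psi>) \<longleftrightarrow> wf_fm \<Theta> \<phi> \<and> wf_fm \<Theta> \<psi>"
| "wf_fm \<Theta> (Neg \<phi>) \<longleftrightarrow> wf_fm \<Theta> \<phi>"
| "wf_fm \<Theta> (Circ \<phi>) \<longleftrightarrow> wf_fm \<Theta> \<phi>"
| "wf_fm \<Theta> (Forall x \<phi>) \<longleftrightarrow> wf_fm \<Theta> \<phi>"
| "wf_fm \<Theta> (Exists x \<phi>) \<longleftrightarrow> wf_fm \<Theta> \<phi>"

fun fv_tm :: "('c, 'f) tm \<Rightarrow> var set" where
  "fv_tm (Var x) = {x}"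
| "fv_tm (Cst c) = {}"
| "fv_tm (App f ts) = (\<Union>t\<in>set ts. fv_tm t)"

fun fv :: "('c, 'f, 'p) fm \<Rightarrow> var set" where
  "fv (Atom p ts) = (\<Union>t\<in>set ts. fv_tm t)"
| "fv (And \<phi> \<psi>) = fv \<phi> \<union> fv \<psi>"
| "fv (Or \<phi> \<psi>) = fv \<phi> \<union> fv \<psi>"
| "fv (Imp \<phi> \<psi>) = fv \<phi> \<union> fv \<psi>"
| "fv (Neg \<phi>) = fv \<phi>"
| "fv (Circ \<phi>) = fv \<phi>"
| "fv (Forall x \<phi>) = fv \<phi> - {x}"
| "fv (Exists x \<phi>) = fv \<phi> - {x}"

definition Ter :: "('c, 'f, 'p) signature \<Rightarrow> ('c, 'f) tm set" where
  "Ter \<Theta> = {t. wf_tm \<Theta> t}"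

definition For :: "('c, 'f, 'p) signature \<Rightarrow> ('c, 'f, 'p) fm set" where
  "For \<Theta> = {\<phi>. wf_fm \<Theta> \<phi>}"

definition Sen :: "('c, 'f, 'p) signature \<Rightarrow> ('c, 'f, 'p) fm set" where
  "Sen \<Theta> = {\<phi> \<in> For \<Theta>. fv \<phi> = {}}"

text \<open>Simultaneous replacement of all free occurrences of variables.  It does not rename bound
  variables, so variables may be captured unless a \<open>free_for\<close> condition is imposed.\<close>

fun tsubst :: "(var \<Rightarrow> ('c, 'f) tm) \<Rightarrow> ('c, 'f) tm \<Rightarrow> ('c, 'f) tm" where
  "tsubst \<sigma> (Var x) = \<sigma> x"
| "tsubst \<sigma> (Cst c) = Cst c"
| "tsubst \<sigma> (App f ts) = App f (map (tsubst \<sigma>) ts)"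

fun fsubst :: "(var \<Rightarrow> ('c, 'f) tm) \<Rightarrow> ('c, 'f, 'p) fm \<Rightarrow> ('c, 'f, 'p) fm" where
  "fsubst \<sigma> (Atom p ts) = Atom p (map (tsubst \<sigma>) ts)"
| "fsubst \<sigma> (And \<phi> \<psi>) = And (fsubst \<sigma> \<phi>) (fsubst \<sigma> \<psi>)"
| "fsubst \<sigma> (Or \<phi> \<psi>) = Or (fsubst \<sigma> \<phi>) (fsubst \<sigma> \<psi>)"
| "fsubst \<sigma> (Imp \<phi> \<psi>) = Imp (fsubst \<sigma> \<phi>) (fsubst \<sigma> \<psi>)"
| "fsubst \<sigma> (Neg \<phi>) = Neg (fsubst \<sigma> \<phi>)"
| "fsubst \<sigma> (Circ \<phi>) = Circ (fsubst \<sigma> \<phi>)"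
| "fsubst \<sigma> (Forall x \<phi>) = Forall x (fsubst (\<sigma>(x := Var x)) \<phi>)"
| "fsubst \<sigma> (Exists x \<phi>) = Exists x (fsubst (\<sigma>(x := Var x)) \<phi>)"

definition subst1 :: "('c, 'f, 'p) fm \<Rightarrow> var \<Rightarrow> ('c, 'f) tm \<Rightarrow> ('c, 'f, 'p) fm"
    ("_\<langle>_ := _\<rangle>" [1000, 0, 0] 1000) where
  "\<phi>\<langle>x := t\<rangle> = fsubst (Var(x := t)) \<phi>"

fun free_for :: "('c, 'f) tm \<Rightarrow> var \<Rightarrow> ('c, 'f, 'p) fm \<Rightarrow> bool" where
  "free_for t x (Atom p ts) \<longleftrightarrow> True"
| "free_for t x (And \<phi> \<psi>) \<longleftrightarrow> free_for t x \<phi> \<and> free_for t x \<psi>"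
| "free_for t x (Or \<phi> \<psi>) \<longleftrightarrow> free_for t x \<phi> \<and> free_for t x \<psi>"
| "free_for t x (Imp \<phi> \<psi>) \<longleftrightarrow> free_for t x \<phi> \<and> free_for t x \<psi>"
| "free_for t x (Neg \<phi>) \<longleftrightarrow> free_for t x \<phi>"
| "free_for t x (Circ \<phi>) \<longleftrightarrow> free_for t x \<phi>"
| "free_for t x (Forall y \<phi>) \<longleftrightarrow> x \<notin> fv (Forall y \<phi>) \<or> y \<notin> fv_tm t \<and> free_for t x \<phi>"
| "free_for t x (Exists y \<phi>) \<longleftrightarrow> x \<notin> fv (Exists y \<phi>) \<or> y \<notin> fv_tm t \<and> free_for t x \<phi>"

text \<open>Variants: finitely many additions or deletions of void quantifiers and renamings of bound
  variables, at arbitrary positions in the formula.  The side conditions of the renaming rules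
  say that \<open>\<phi>\<langle>x := Var y\<rangle>\<close> has free \<open>y\<close> exactly where \<open>\<phi>\<close> has free \<open>x\<close>.\<close>

inductive variant :: "('c, 'f, 'p) fm \<Rightarrow> ('c, 'f, 'p) fm \<Rightarrow> bool" where
  refl: "variant \<phi> \<phi>"
| sym: "variant \<phi> \<psi> \<Longrightarrow> variant \<psi> \<phi>"
| trans: "variant \<phi> \<psi> \<Longrightarrow> variant \<psi> \<chi> \<Longrightarrow> variant \<phi> \<chi>"
| void_Forall: "x \<notin> fv \<phi> \<Longrightarrow> variant \<phi> (Forall x \<phi>)"
| void_Exists: "x \<notin> fv \<phi> \<Longrightarrow> variant \<phi> (Exists x \<phi>)"
| rename_Forall: "y \<notin> fv \<phi> \<Longrightarrow> free_for (Var y) x \<phi> \<Longrightarrow>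
    variant (Forall x \<phi>) (Forall y (\<phi>\<langle>x := Var y\<rangle>))"
| rename_Exists: "y \<notin> fv \<phi> \<Longrightarrow> free_for (Var y) x \<phi> \<Longrightarrow>
    variant (Exists x \<phi>) (Exists y (\<phi>\<langle>x := Var y\<rangle>))"
| And: "variant \<phi> \<phi>' \<Longrightarrow> variant \<psi> \<psi>' \<Longrightarrow> variant (And \<phi> \<psi>) (And \<phi>' \<psi>')"
| Or: "variant \<phi> \<phi>' \<Longrightarrow> variant \<psi> \<psi>' \<Longrightarrow> variant (Or \<phi> \<psi>) (Or \<phi>' \<psi>')"
| Imp: "variant \<phi> \<phi>' \<Longrightarrow> variant \<psi> \<psi>' \<Longrightarrow> variant (Imp \<phi> \<psi>) (Imp \<phi>' \<psi>')"
| Neg: "variant \<phi> \<phi>' \<Longrightarrow> variant (Neg \<phi>) (Neg \<phi>')"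
| Circ: "variant \<phi> \<phi>' \<Longrightarrow> variant (Circ \<phi>) (Circ \<phi>')"
| Forall: "variant \<phi> \<phi>' \<Longrightarrow> variant (Forall x \<phi>) (Forall x \<phi>')"
| Exists: "variant \<phi> \<phi>' \<Longrightarrow> variant (Exists x \<phi>) (Exists x \<phi>')"


section \<open>The Hilbert calculus QmbC\<close>

inductive QmbC_axiom :: "('c, 'f, 'p) fm \<Rightarrow> bool" where
  A1: "QmbC_axiom (Imp \<alpha> (Imp \<beta> \<alpha>))"
| A2: "QmbC_axiom (Imp (Imp \<alpha> (Imp \<beta> \<gamma>)) (Imp (Imp \<alpha> \<beta>) (Imp \<alpha> \<gamma>)))"
| A3: "QmbC_axiom (Imp \<alpha> (Imp \<beta> (And \<alpha> \<beta>)))"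
| A4: "QmbC_axiom (Imp (And \<alpha> \<beta>) \<alpha>)"
| A5: "QmbC_axiom (Imp (And \<alpha> \<beta>) \<beta>)"
| A6: "QmbC_axiom (Imp \<alpha> (Or \<alpha> \<beta>))"
| A7: "QmbC_axiom (Imp \<beta> (Or \<alpha> \<beta>))"
| A8: "QmbC_axiom (Imp (Imp \<alpha> \<gamma>) (Imp (Imp \<beta> \<gamma>) (Imp (Or \<alpha> \<beta>) \<gamma>)))"
| A9: "QmbC_axiom (Or \<alpha> (Imp \<alpha> \<beta>))"
| A10: "QmbC_axiom (Or \<alpha> (Neg \<alpha>))"
| A11: "QmbC_axiom (Imp (Circ \<alpha>) (Imp \<alpha> (Imp (Neg \<alpha>) \<beta>)))"
| Ax12: "free_for t x \<phi> \<Longrightarrow> QmbC_axiom (Imp (\<phi>\<langle>x := t\<rangle>) (Exists x \<phi>))"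
| Ax13: "free_for t x \<phi> \<Longrightarrow> QmbC_axiom (Imp (Forall x \<phi>) (\<phi>\<langle>x := t\<rangle>))"
| Ax14: "variant \<alpha> \<beta> \<Longrightarrow> QmbC_axiom (Imp \<alpha> \<beta>)"

text \<open>Derivability over the formulas of \<open>\<Theta>\<close>; every formula in a derivation belongs to \<open>For \<Theta>\<close>.\<close>

inductive QmbC_derivable ::
    "('c, 'f, 'p) signature \<Rightarrow> ('c, 'f, 'p) fm set \<Rightarrow> ('c, 'f, 'p) fm \<Rightarrow> bool"
  for \<Theta> \<Gamma> where
  ax: "QmbC_axiom \<phi> \<Longrightarrow> \<phi> \<in> For \<Theta> \<Longrightarrow> QmbC_derivable \<Theta> \<Gamma> \<phi>"
| hyp: "\<phi> \<in> \<Gamma> \<Longrightarrow> \<phi> \<in> For \<Theta> \<Longrightarrow> QmbC_derivable \<Theta> \<Gamma> \<phi>"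
| MP: "QmbC_derivable \<Theta> \<Gamma> \<alpha> \<Longrightarrow> QmbC_derivable \<Theta> \<Gamma> (Imp \<alpha> \<beta>) \<Longrightarrow> QmbC_derivable \<Theta> \<Gamma> \<beta>"
| Exists_In: "QmbC_derivable \<Theta> \<Gamma> (Imp \<phi> \<psi>) \<Longrightarrow> x \<notin> fv \<psi> \<Longrightarrow>
    QmbC_derivable \<Theta> \<Gamma> (Imp (Exists x \<phi>) \<psi>)"
| Forall_In: "QmbC_derivable \<Theta> \<Gamma> (Imp \<phi> \<psi>) \<Longrightarrow> x \<notin> fv \<phi> \<Longrightarrow>
    QmbC_derivable \<Theta> \<Gamma> (Imp \<phi> (Forall x \<psi>))"


section \<open>Swap structures for mbC\<close>

type_synonym 'a triple = "'a \<times> 'a \<times> 'a"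

definition pr1 :: "'a triple \<Rightarrow> 'a" where "pr1 x = fst x"
definition pr2 :: "'a triple \<Rightarrow> 'a" where "pr2 x = fst (snd x)"
definition pr3 :: "'a triple \<Rightarrow> 'a" where "pr3 x = snd (snd x)"

definition swap_universe :: "'a::boolean_algebra triple set" where
  "swap_universe = {x. pr1 x \<squnion> pr2 x = \<top> \<and> pr1 x \<sqinter> pr2 x \<sqinter> pr3 x = \<bottom>}"

record 'a multialgebra =
  elems :: "'a triple set"
  m_and :: "'a triple \<Rightarrow> 'a triple \<Rightarrow> 'a triple set"
  m_or :: "'a triple \<Rightarrow> 'a triple \<Rightarrow> 'a triple set"
  m_imp :: "'a triple \<Rightarrow> 'a triple \<Rightarrow> 'a triple set"
  m_neg :: "'a triple \<Rightarrow> 'a triple set"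
  m_circ :: "'a triple \<Rightarrow> 'a triple set"

text \<open>The implication of a Boolean algebra is \<open>- a \<squnion> b\<close>.\<close>

locale swap_structure =
  fixes \<B> :: "'a::boolean_algebra multialgebra"
  assumes elems_nonempty: "elems \<B> \<noteq> {}"
    and elems_subset: "elems \<B> \<subseteq> swap_universe"
    and m_and: "\<And>x y. x \<in> elems \<B> \<Longrightarrow> y \<in> elems \<B> \<Longrightarrow>
      m_and \<B> x y \<noteq> {} \<and> m_and \<B> x y \<subseteq> {z \<in> elems \<B>. pr1 z = pr1 x \<sqinter> pr1 y}"
    and m_or: "\<And>x y. x \<in> elems \<B> \<Longrightarrow> y \<in> elems \<B> \<Longrightarrow>
      m_or \<B> x y \<noteq> {} \<and> m_or \<B> x y \<subseteq> {z \<in> elems \<B>. pr1 z = pr1 x \<squnion> pr1 y}"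
    and m_imp: "\<And>x y. x \<in> elems \<B> \<Longrightarrow> y \<in> elems \<B> \<Longrightarrow>
      m_imp \<B> x y \<noteq> {} \<and> m_imp \<B> x y \<subseteq> {z \<in> elems \<B>. pr1 z = - pr1 x \<squnion> pr1 y}"
    and m_neg: "\<And>x. x \<in> elems \<B> \<Longrightarrow>
      m_neg \<B> x \<noteq> {} \<and> m_neg \<B> x \<subseteq> {z \<in> elems \<B>. pr1 z = pr2 x}"
    and m_circ: "\<And>x. x \<in> elems \<B> \<Longrightarrow>
      m_circ \<B> x \<noteq> {} \<and> m_circ \<B> x \<subseteq> {z \<in> elems \<B>. pr1 z = pr3 x}"

definition designated :: "'a::boolean_algebra multialgebra \<Rightarrow> 'a triple set" where
  "designated \<B> = {x \<in> elems \<B>. pr1 x = \<top>}"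


section \<open>First-order structures and valuations\<close>

record ('c, 'f, 'p, 'u, 'a) interp =
  univ :: "'u set"
  cI :: "'c \<Rightarrow> 'u"
  fI :: "'f \<Rightarrow> 'u list \<Rightarrow> 'u"
  pI :: "'p \<Rightarrow> 'u list \<Rightarrow> 'a triple"

locale fo_structure =
  fixes \<Theta> :: "('c, 'f, 'p) signature"
    and \<B> :: "'a multialgebra"
    and \<AA> :: "('c, 'f, 'p, 'u, 'a) interp"
  assumes univ_nonempty: "univ \<AA> \<noteq> {}"
    and cI: "\<And>c. c \<in> csyms \<Theta> \<Longrightarrow> cI \<AA> c \<in> univ \<AA>"
    and fI: "\<And>f us. f \<in> fsyms \<Theta> (length us) \<Longrightarrow> set us \<subseteq> univ \<AA> \<Longrightarrow> fI \<AA> f us \<in> univ \<AA>"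
    and pI: "\<And>p us. p \<in> psyms \<Theta> (length us) \<Longrightarrow> set us \<subseteq> univ \<AA> \<Longrightarrow> pI \<AA> p us \<in> elems \<B>"

text \<open>The diagram language \<open>\<Theta>\<^sub>U\<close>: constants of \<open>\<Theta>\<close> are tagged with \<open>Inl\<close>, and \<open>Cst (Inr a)\<close>
  is the new constant naming the individual \<open>a\<close>.  The map \<open>lift_fm\<close> is the inclusion of
  \<open>For \<Theta>\<close> into \<open>For \<Theta>\<^sub>U\<close>.\<close>

definition diag_sig :: "('c, 'f, 'p) signature \<Rightarrow> 'u set \<Rightarrow> ('c + 'u, 'f, 'p) signature" where
  "diag_sig \<Theta> U = \<lparr>csyms = Inl ` csyms \<Theta> \<union> Inr ` U, fsyms = fsyms \<Theta>, psyms = psyms \<Theta>\<rparr>"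

definition diag_interp ::
    "('c, 'f, 'p, 'u, 'a) interp \<Rightarrow> ('c + 'u, 'f, 'p, 'u, 'a) interp" where
  "diag_interp \<AA> = \<lparr>univ = univ \<AA>, cI = case_sum (cI \<AA>) (\<lambda>a. a), fI = fI \<AA>, pI = pI \<AA>\<rparr>"

definition name :: "'u \<Rightarrow> ('c + 'u, 'f) tm" where
  "name a = Cst (Inr a)"

definition lift_fm :: "('c, 'f, 'p) fm \<Rightarrow> ('c + 'u, 'f, 'p) fm" where
  "lift_fm = map_fm Inl (\<lambda>f. f) (\<lambda>p. p)"

definition assignments :: "('c, 'f, 'p, 'u, 'a) interp \<Rightarrow> (var \<Rightarrow> 'u) set" where
  "assignments \<AA> = {\<mu>. \<forall>x. \<mu> x \<in> univ \<AA>}"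

fun tm_val :: "('c, 'f, 'p, 'u, 'a) interp \<Rightarrow> (var \<Rightarrow> 'u) \<Rightarrow> ('c, 'f) tm \<Rightarrow> 'u" where
  "tm_val \<AA> \<mu> (Var x) = \<mu> x"
| "tm_val \<AA> \<mu> (Cst c) = cI \<AA> c"
| "tm_val \<AA> \<mu> (App f ts) = fI \<AA> f (map (tm_val \<AA> \<mu>) ts)"

text \<open>\<open>ground \<mu>\<close> replaces every free variable \<open>x\<close> by the name of \<open>\<mu> x\<close>.\<close>

definition ground :: "(var \<Rightarrow> 'u) \<Rightarrow> ('c + 'u, 'f, 'p) fm \<Rightarrow> ('c + 'u, 'f, 'p) fm" where
  "ground \<mu> \<phi> = fsubst (\<lambda>x. name (\<mu> x)) \<phi>"

text \<open>The sort \<open>{boolean_algebra, complete_lattice}\<close> is that of complete Boolean algebras.  The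
  library class \<open>complete_boolean_algebra\<close> is not used, since it in addition demands complete
  distributivity.

  Valuations are total functions on formulas of which only the restriction to \<open>Sen \<Theta>\<^sub>U\<close> is
  constrained.  In \<open>val_Atom\<close> the terms are closed, so the choice of \<open>\<mu>\<close> is immaterial.\<close>

locale QmbC_valuation =
  fixes \<Theta> :: "('c, 'f, 'p) signature"
    and \<B> :: "'a::{boolean_algebra, complete_lattice} multialgebra"
    and \<AA> :: "('c, 'f, 'p, 'u, 'a) interp"
    and v :: "('c + 'u, 'f, 'p) fm \<Rightarrow> 'a triple"
  assumes val_elems: "\<And>\<phi>. \<phi> \<in> Sen (diag_sig \<Theta> (univ \<AA>)) \<Longrightarrow> v \<phi> \<in> elems \<B>"
    and val_Atom: "\<And>p ts \<mu>. Atom p ts \<in> Sen (diag_sig \<Theta> (univ \<AA>)) \<Longrightarrow> \<mu> \<in> assignments \<AA> \<Longrightarrow>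
      v (Atom p ts) = pI \<AA> p (map (tm_val (diag_interp \<AA>) \<mu>) ts)"
    and val_Neg: "\<And>\<phi>. \<phi> \<in> Sen (diag_sig \<Theta> (univ \<AA>)) \<Longrightarrow> v (Neg \<phi>) \<in> m_neg \<B> (v \<phi>)"
    and val_Circ: "\<And>\<phi>. \<phi> \<in> Sen (diag_sig \<Theta> (univ \<AA>)) \<Longrightarrow> v (Circ \<phi>) \<in> m_circ \<B> (v \<phi>)"
    and val_And: "\<And>\<phi> \<psi>. \<phi> \<in> Sen (diag_sig \<Theta> (univ \<AA>)) \<Longrightarrow> \<psi> \<in> Sen (diag_sig \<Theta> (univ \<AA>)) \<Longrightarrow>
      v (And \<phi> \<psi>) \<in> m_and \<B> (v \<phi>) (v \<psi>)"
    and val_Or: "\<And>\<phi> \<psi>. \<phi> \<in> Sen (diag_sig \<Theta> (univ \<AA>)) \<Longrightarrow> \<psi> \<in> Sen (diag_sig \<Theta> (univ \<AA>)) \<Longrightarrow>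
      v (Or \<phi> \<psi>) \<in> m_or \<B> (v \<phi>) (v \<psi>)"
    and val_Imp: "\<And>\<phi> \<psi>. \<phi> \<in> Sen (diag_sig \<Theta> (univ \<AA>)) \<Longrightarrow> \<psi> \<in> Sen (diag_sig \<Theta> (univ \<AA>)) \<Longrightarrow>
      v (Imp \<phi> \<psi>) \<in> m_imp \<B> (v \<phi>) (v \<psi>)"
    and val_Forall: "\<And>x \<phi>. Forall x \<phi> \<in> Sen (diag_sig \<Theta> (univ \<AA>)) \<Longrightarrow>
      pr1 (v (Forall x \<phi>)) = (\<Sqinter>a\<in>univ \<AA>. pr1 (v (\<phi>\<langle>x := name a\<rangle>)))"
    and val_Exists: "\<And>x \<phi>. Exists x \<phi> \<in> Sen (diag_sig \<Theta> (univ \<AA>)) \<Longrightarrow>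
      pr1 (v (Exists x \<phi>)) = (\<Squnion>a\<in>univ \<AA>. pr1 (v (\<phi>\<langle>x := name a\<rangle>)))"
    and subst_unary: "\<And>h \<phi> z t \<mu> b.
      \<lbrakk>h \<in> {Neg, Circ};
       \<phi> \<in> For (diag_sig \<Theta> (univ \<AA>)); t \<in> Ter (diag_sig \<Theta> (univ \<AA>)); free_for t z \<phi>;
       \<mu> \<in> assignments \<AA>; b = tm_val (diag_interp \<AA>) \<mu> t;
       v (ground \<mu> (\<phi>\<langle>z := t\<rangle>)) = v (ground \<mu> (\<phi>\<langle>z := name b\<rangle>))\<rbrakk>
      \<Longrightarrow> v (ground \<mu> ((h \<phi>)\<langle>z := t\<rangle>)) = v (ground \<mu> ((h \<phi>)\<langle>z := name b\<rangle>))"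
    and subst_binary: "\<And>h \<phi> \<psi> z t \<mu> b.
      \<lbrakk>h \<in> {And, Or, Imp};
       \<phi> \<in> For (diag_sig \<Theta> (univ \<AA>)); \<psi> \<in> For (diag_sig \<Theta> (univ \<AA>));
       t \<in> Ter (diag_sig \<Theta> (univ \<AA>)); free_for t z \<phi>; free_for t z \<psi>;
       \<mu> \<in> assignments \<AA>; b = tm_val (diag_interp \<AA>) \<mu> t;
       v (ground \<mu> (\<phi>\<langle>z := t\<rangle>)) = v (ground \<mu> (\<phi>\<langle>z := name b\<rangle>));
       v (ground \<mu> (\<psi>\<langle>z := t\<rangle>)) = v (ground \<mu> (\<psi>\<langle>z := name b\<rangle>))\<rbrakk>
      \<Longrightarrow> v (ground \<mu> ((h \<phi> \<psi>)\<langle>z := t\<rangle>)) = v (ground \<mu> ((h \<phi> \<psi>)\<langle>z := name b\<rangle>))"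
    and subst_quant: "\<And>Q x \<phi> z t \<mu> b.
      \<lbrakk>Q \<in> {Forall, Exists};
       \<phi> \<in> For (diag_sig \<Theta> (univ \<AA>)); t \<in> Ter (diag_sig \<Theta> (univ \<AA>)); free_for t z \<phi>;
       \<mu> \<in> assignments \<AA>; b = tm_val (diag_interp \<AA>) \<mu> t;
       x \<noteq> z; x \<notin> fv_tm t;
       \<forall>a\<in>univ \<AA>. v (ground (\<mu>(x := a)) (\<phi>\<langle>z := t\<rangle>)) = v (ground (\<mu>(x := a)) (\<phi>\<langle>z := name b\<rangle>))\<rbrakk>
      \<Longrightarrow> v (ground \<mu> ((Q x \<phi>)\<langle>z := t\<rangle>)) = v (ground \<mu> ((Q x \<phi>)\<langle>z := name b\<rangle>))"
    and val_variant: "\<And>\<phi> \<phi>'. \<phi> \<in> Sen (diag_sig \<Theta> (univ \<AA>)) \<Longrightarrow>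
      \<phi>' \<in> Sen (diag_sig \<Theta> (univ \<AA>)) \<Longrightarrow> variant \<phi> \<phi>' \<Longrightarrow> v \<phi> = v \<phi>'"


section \<open>Semantical consequence\<close>

definition val_at :: "(('c + 'u, 'f, 'p) fm \<Rightarrow> 'a triple) \<Rightarrow> (var \<Rightarrow> 'u) \<Rightarrow>
    ('c + 'u, 'f, 'p) fm \<Rightarrow> 'a triple" where
  "val_at v \<mu> \<phi> = v (ground \<mu> \<phi>)"

definition entails_in :: "('c, 'f, 'p) signature \<Rightarrow>
    'a::{boolean_algebra, complete_lattice} multialgebra \<Rightarrow> ('c, 'f, 'p, 'u, 'a) interp \<Rightarrow>
    ('c, 'f, 'p) fm set \<Rightarrow> ('c, 'f, 'p) fm \<Rightarrow> bool" where
  "entails_in \<Theta> \<B> \<AA> \<Gamma> \<phi> \<longleftrightarrow>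
    (\<forall>v. QmbC_valuation \<Theta> \<B> \<AA> v \<longrightarrow>
      (\<forall>\<gamma>\<in>\<Gamma>. \<forall>\<mu>\<in>assignments \<AA>. val_at v \<mu> (lift_fm \<gamma>) \<in> designated \<B>) \<longrightarrow>
      (\<forall>\<mu>\<in>assignments \<AA>. val_at v \<mu> (lift_fm \<phi>) \<in> designated \<B>))"

text \<open>HOL cannot quantify over types inside a formula, so the consequence relation is indexed by
  the type \<open>'a\<close> carrying the complete Boolean algebra and the type \<open>'u\<close> from which the domains
  are taken.  A theorem with \<open>'a\<close> and \<open>'u\<close> as type variables speaks about all complete Boolean
  algebras and all domains.\<close>

definition QmbC_entails :: "'a::{boolean_algebra, complete_lattice} itself \<Rightarrow> 'u itself \<Rightarrow>
    ('c, 'f, 'p) signature \<Rightarrow> ('c, 'f, 'p) fm set \<Rightarrow> ('c, 'f, 'p) fm \<Rightarrow> bool" where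
  "QmbC_entails TYPE('a) TYPE('u) \<Theta> \<Gamma> \<phi> \<longleftrightarrow>
    (\<forall>(\<B> :: 'a multialgebra) (\<AA> :: ('c, 'f, 'p, 'u, 'a) interp).
      swap_structure \<B> \<longrightarrow> fo_structure \<Theta> \<B> \<AA> \<longrightarrow> entails_in \<Theta> \<B> \<AA> \<Gamma> \<phi>)"

unbundle no lattice_syntax

end

theory Submission
  imports Defs
begin

text \<open>Soundness goes by induction on derivations, reading validity of an implication as the
  order of first coordinates.  The substitution clauses (vi) are exactly what is needed to prove,
  by induction on \<open>\<phi>\<close>, that \<open>\<phi>\<langle>z := t\<rangle>\<close> and \<open>\<phi>\<langle>z := name b\<rangle>\<close> have the same value whenever \<open>b\<close>
  is the value of \<open>t\<close>; this yields the two quantifier axioms.  The quantifier rules only use that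
  infima and suprema are greatest lower and least upper bounds, so no infinite distributivity is needed.\<close>

section \<open>Substitution\<close>

lemma tsubst_cong: "(\<And>x. x \<in> fv_tm t \<Longrightarrow> \<sigma> x = \<tau> x) \<Longrightarrow> tsubst \<sigma> t = tsubst \<tau> t"
  by (induction t) auto

lemma fsubst_cong: "(\<And>x. x \<in> fv \<phi> \<Longrightarrow> \<sigma> x = \<tau> x) \<Longrightarrow> fsubst \<sigma> \<phi> = fsubst \<tau> \<phi>"
proof (induction \<phi> arbitrary: \<sigma> \<tau>)
  case (Atom p ts)
  then show ?case by (auto intro!: tsubst_cong)
next
  case (Forall x \<phi>)
  have "fsubst (\<sigma>(x := Var x)) \<phi> = fsubst (\<tau>(x := Var x)) \<phi>"
    by (rule Forall.IH) (use Forall.prems in auto)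
  then show ?case by simp
next
  case (Exists x \<phi>)
  have "fsubst (\<sigma>(x := Var x)) \<phi> = fsubst (\<tau>(x := Var x)) \<phi>"
    by (rule Exists.IH) (use Exists.prems in auto)
  then show ?case by simp
next
  case (And \<phi> \<psi>)
  show ?case using And.prems And.IH(1) [of \<sigma> \<tau>] And.IH(2) [of \<sigma> \<tau>] by auto
next
  case (Or \<phi> \<psi>)
  show ?case using Or.prems Or.IH(1) [of \<sigma> \<tau>] Or.IH(2) [of \<sigma> \<tau>] by auto
next
  case (Imp \<phi> \<psi>)
  show ?case using Imp.prems Imp.IH(1) [of \<sigma> \<tau>] Imp.IH(2) [of \<sigma> \<tau>] by auto
next
  case (Neg \<phi>)
  show ?case using Neg.prems Neg.IH [of \<sigma> \<tau>] by auto
next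
  case (Circ \<phi>)
  show ?case using Circ.prems Circ.IH [of \<sigma> \<tau>] by auto
qed

lemma tsubst_Var [simp]: "tsubst Var t = t"
  by (induction t) (auto intro: map_idI)

lemma fsubst_Var [simp]: "fsubst Var \<phi> = \<phi>"
  by (induction \<phi>) (auto intro: map_idI)

lemma tsubst_closed: "fv_tm t = {} \<Longrightarrow> tsubst \<sigma> t = t"
  using tsubst_cong [of t \<sigma> Var] by simp

lemma subst1_fresh: "x \<notin> fv \<phi> \<Longrightarrow> \<phi>\<langle>x := t\<rangle> = \<phi>"
  unfolding subst1_def using fsubst_cong [of \<phi> "Var(x := t)" Var] by force

lemma tsubst_tsubst: "tsubst \<tau> (tsubst \<sigma> t) = tsubst (\<lambda>x. tsubst \<tau> (\<sigma> x)) t"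
  by (induction t) auto

lemma fv_tsubst: "fv_tm (tsubst \<sigma> t) = (\<Union>x\<in>fv_tm t. fv_tm (\<sigma> x))"
  by (induction t) auto

lemma free_for_closed: "fv_tm t = {} \<Longrightarrow> free_for t x \<phi>"
  by (induction \<phi>) auto

text \<open>The binder case of \<open>fsubst_subst1\<close>, shared by both quantifiers. The
  assumptions are conditional because \<open>free_for\<close> constrains the bound variable only
  where \<open>x\<close> is really replaced below it.\<close>

lemma subst1_quant:
  assumes "y \<noteq> x \<Longrightarrow> x \<in> fv \<phi> \<Longrightarrow> y \<notin> fv_tm t"
    and IH: "\<And>\<sigma>. y \<noteq> x \<Longrightarrow> x \<in> fv \<phi> \<Longrightarrow>
      fsubst \<sigma> (\<phi>\<langle>x := t\<rangle>) = fsubst (\<sigma>(x := tsubst \<sigma> t)) \<phi>"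
  shows "fsubst (\<sigma>(y := Var y)) (fsubst ((Var(x := t))(y := Var y)) \<phi>) =
    fsubst ((\<sigma>(x := tsubst \<sigma> t))(y := Var y)) \<phi>"
proof (cases "y = x \<or> x \<notin> fv \<phi>")
  case True
  \<comment> \<open>Here the inner substitution moves no free variable of \<phi>, and the outer ones
    agree on these variables.\<close>
  then have "fsubst ((Var(x := t))(y := Var y)) \<phi> = fsubst Var \<phi>"
    by (intro fsubst_cong) auto
  then show ?thesis using True by (auto intro: fsubst_cong)
next
  case False
  then have "y \<notin> fv_tm t" using assms(1) by blast
  \<comment> \<open>Resetting \<sigma> at \<open>y\<close> does not affect the image of
    \<open>t\<close>, and the updates at \<open>x\<close> and \<open>y\<close> commute.\<close>
  then have "tsubst (\<sigma>(y := Var y)) t = tsubst \<sigma> t" by (intro tsubst_cong) auto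
  moreover have "(Var(x := t))(y := Var y) = Var(x := t)" using False by auto
  ultimately show ?thesis
    using IH [of "\<sigma>(y := Var y)"] False by (simp add: subst1_def fun_upd_twist)
qed

text \<open>No variable of \<open>t\<close> gets bound where \<open>t\<close> is inserted, so a
  later substitution acts on every inserted copy as it does on \<open>t\<close> alone.\<close>

lemma fsubst_subst1:
  "free_for t x \<phi> \<Longrightarrow> fsubst \<sigma> (\<phi>\<langle>x := t\<rangle>) = fsubst (\<sigma>(x := tsubst \<sigma> t)) \<phi>"
proof (induction \<phi> arbitrary: \<sigma>)
  case (Atom p ts)
  show ?case by (auto simp: subst1_def tsubst_tsubst intro!: tsubst_cong)
next
  case (Forall y \<phi>)
  have fresh: "y \<notin> fv_tm t" "free_for t x \<phi>" if "y \<noteq> x" "x \<in> fv \<phi>"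
    using Forall.prems that by auto
  show ?case unfolding subst1_def fsubst.simps
    by (rule arg_cong [where f = "Forall y"], rule subst1_quant [OF fresh(1) Forall.IH [OF fresh(2)]])
next
  case (Exists y \<phi>)
  have fresh: "y \<notin> fv_tm t" "free_for t x \<phi>" if "y \<noteq> x" "x \<in> fv \<phi>"
    using Exists.prems that by auto
  show ?case unfolding subst1_def fsubst.simps
    by (rule arg_cong [where f = "Exists y"], rule subst1_quant [OF fresh(1) Exists.IH [OF fresh(2)]])
qed (simp_all add: subst1_def)

text \<open>Partial instantiations by closed terms: the form that grounding takes below quantifiers.
  They never capture variables.\<close>

definition partial_ground :: "(var \<Rightarrow> ('c, 'f) tm) \<Rightarrow> bool" where
  "partial_ground \<sigma> \<longleftrightarrow> (\<forall>x. \<sigma> x = Var x \<or> fv_tm (\<sigma> x) = {})"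

lemma partial_ground_upd [simp]: "partial_ground \<sigma> \<Longrightarrow> partial_ground (\<sigma>(x := Var x))"
  by (auto simp: partial_ground_def)

text \<open>For \<open>x\<close> other than \<open>y\<close> the term \<open>\<sigma> x\<close>
  never contains \<open>y\<close>, so resetting \<tau> there makes no difference. This carries
  compositions under a binder.\<close>

lemma tsubst_upd_partial_ground:
  assumes "partial_ground \<sigma>"
  shows "(\<lambda>x. tsubst (\<tau>(y := Var y)) ((\<sigma>(y := Var y)) x)) = (\<lambda>x. tsubst \<tau> (\<sigma> x))(y := Var y)"
proof
  fix x
  have "\<sigma> x = Var x \<or> fv_tm (\<sigma> x) = {}" using assms by (simp add: partial_ground_def)
  then show "tsubst (\<tau>(y := Var y)) ((\<sigma>(y := Var y)) x) = ((\<lambda>x. tsubst \<tau> (\<sigma> x))(y := Var y)) x"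
    by (auto simp: tsubst_closed)
qed

text \<open>As \<open>fsubst\<close> does not rename, composing arbitrary substitutions may capture
  variables; \<sigma> inserts only closed terms, in which nothing can be captured.\<close>

lemma fsubst_fsubst_partial_ground:
  "partial_ground \<sigma> \<Longrightarrow> fsubst \<tau> (fsubst \<sigma> \<phi>) = fsubst (\<lambda>x. tsubst \<tau> (\<sigma> x)) \<phi>"
proof (induction \<phi> arbitrary: \<sigma> \<tau>)
  case (Atom p ts)
  show ?case by (simp add: tsubst_tsubst)
next
  case (Forall y \<phi>)
  have "fsubst (\<tau>(y := Var y)) (fsubst (\<sigma>(y := Var y)) \<phi>) =
      fsubst ((\<lambda>x. tsubst \<tau> (\<sigma> x))(y := Var y)) \<phi>"
    unfolding tsubst_upd_partial_ground [OF Forall.prems, symmetric]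
    by (rule Forall.IH [OF partial_ground_upd [OF Forall.prems]])
  then show ?case unfolding fsubst.simps by (rule arg_cong)
next
  case (Exists y \<phi>)
  have "fsubst (\<tau>(y := Var y)) (fsubst (\<sigma>(y := Var y)) \<phi>) =
      fsubst ((\<lambda>x. tsubst \<tau> (\<sigma> x))(y := Var y)) \<phi>"
    unfolding tsubst_upd_partial_ground [OF Exists.prems, symmetric]
    by (rule Exists.IH [OF partial_ground_upd [OF Exists.prems]])
  then show ?case unfolding fsubst.simps by (rule arg_cong)
qed simp_all

lemma fv_tsubst_partial_ground: "partial_ground \<sigma> \<Longrightarrow> fv_tm (tsubst \<sigma> t) \<subseteq> fv_tm t"
proof -
  assume "partial_ground \<sigma>"
  then have "fv_tm (\<sigma> x) \<subseteq> {x}" for x by (metis partial_ground_def empty_subsetI fv_tm.simps(1) order_refl)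
  then show ?thesis by (auto simp: fv_tsubst)
qed

lemma fv_fsubst_partial_ground: "partial_ground \<sigma> \<Longrightarrow> fv (fsubst \<sigma> \<phi>) \<subseteq> fv \<phi>"
proof (induction \<phi> arbitrary: \<sigma>)
  case (Atom p ts)
  then show ?case using fv_tsubst_partial_ground by fastforce
next
  case (Forall y \<phi>)
  then have "fv (fsubst (\<sigma>(y := Var y)) \<phi>) \<subseteq> fv \<phi>"
    by (intro Forall.IH partial_ground_upd)
  then show ?case by auto
next
  case (Exists y \<phi>)
  then have "fv (fsubst (\<sigma>(y := Var y)) \<phi>) \<subseteq> fv \<phi>"
    by (intro Exists.IH partial_ground_upd)
  then show ?case by auto
next
  case (And \<phi> \<psi>)
  show ?case using And.prems And.IH(1) [of \<sigma>] And.IH(2) [of \<sigma>] by auto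
next
  case (Or \<phi> \<psi>)
  show ?case using Or.prems Or.IH(1) [of \<sigma>] Or.IH(2) [of \<sigma>] by auto
next
  case (Imp \<phi> \<psi>)
  show ?case using Imp.prems Imp.IH(1) [of \<sigma>] Imp.IH(2) [of \<sigma>] by auto
next
  case (Neg \<phi>)
  show ?case using Neg.prems Neg.IH [of \<sigma>] by auto
next
  case (Circ \<phi>)
  show ?case using Circ.prems Circ.IH [of \<sigma>] by auto
qed

text \<open>Instantiation by closed terms moves no binder and creates no free occurrence of
  \<open>x\<close>, so the positions that \<open>free_for\<close> inspects can only
  disappear.\<close>

lemma free_for_fsubst_partial_ground:
  "partial_ground \<sigma> \<Longrightarrow> free_for t x \<phi> \<Longrightarrow> free_for t x (fsubst \<sigma> \<phi>)"
proof (induction \<phi> arbitrary: \<sigma>)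
  case (Forall y \<phi>)
  then show ?case using fv_fsubst_partial_ground [OF partial_ground_upd, of \<sigma> y \<phi>]
    by (auto simp del: fun_upd_apply)
next
  case (Exists y \<phi>)
  then show ?case using fv_fsubst_partial_ground [OF partial_ground_upd, of \<sigma> y \<phi>]
    by (auto simp del: fun_upd_apply)
qed simp_all

text \<open>For the renaming cases of \<open>variant_fsubst\<close>. Both sides collapse to a single
  substitution into \<phi>, and these are compared on the free variables of \<phi>, among which
  \<open>y\<close> does not occur.\<close>

lemma fsubst_rename:
  assumes "partial_ground \<sigma>" and "y \<notin> fv \<phi>" and "free_for (Var y) x \<phi>"
  shows "fsubst (\<sigma>(y := Var y)) (\<phi>\<langle>x := Var y\<rangle>) = (fsubst (\<sigma>(x := Var x)) \<phi>)\<langle>x := Var y\<rangle>"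
proof -
  have "fsubst (\<sigma>(y := Var y)) (\<phi>\<langle>x := Var y\<rangle>) = fsubst (\<sigma>(y := Var y, x := Var y)) \<phi>"
    using fsubst_subst1 [OF assms(3)] by (metis fun_upd_same tsubst.simps(1))
  also have "\<dots> = fsubst (\<lambda>z. tsubst (Var(x := Var y)) ((\<sigma>(x := Var x)) z)) \<phi>"
  proof (rule fsubst_cong)
    fix z assume "z \<in> fv \<phi>"
    with assms(2) have "z \<noteq> y" by blast
    moreover have "\<sigma> z = Var z \<or> fv_tm (\<sigma> z) = {}" using assms(1) by (simp add: partial_ground_def)
    ultimately show "(\<sigma>(y := Var y, x := Var y)) z = tsubst (Var(x := Var y)) ((\<sigma>(x := Var x)) z)"
      by (auto simp: tsubst_closed)
  qed
  also have "\<dots> = (fsubst (\<sigma>(x := Var x)) \<phi>)\<langle>x := Var y\<rangle>"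
    unfolding subst1_def using assms(1) by (simp only: fsubst_fsubst_partial_ground partial_ground_upd)
  finally show ?thesis .
qed

text \<open>Clause \<open>val_variant\<close> speaks of sentences, so variants have to be carried to
  their ground instances. The induction runs over all partial groundings, because below a quantifier
  the bound variable is left in place.\<close>

lemma variant_fsubst: "variant \<phi> \<psi> \<Longrightarrow> partial_ground \<sigma> \<Longrightarrow> variant (fsubst \<sigma> \<phi>) (fsubst \<sigma> \<psi>)"
proof (induction arbitrary: \<sigma> rule: variant.induct)
  case (void_Forall x \<phi>)
  have "fsubst (\<sigma>(x := Var x)) \<phi> = fsubst \<sigma> \<phi>"
    using void_Forall.hyps by (intro fsubst_cong) auto
  then show ?case
    using void_Forall fv_fsubst_partial_ground by (fastforce intro: variant.void_Forall)
next
  case (void_Exists x \<phi>)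
  have "fsubst (\<sigma>(x := Var x)) \<phi> = fsubst \<sigma> \<phi>"
    using void_Exists.hyps by (intro fsubst_cong) auto
  then show ?case
    using void_Exists fv_fsubst_partial_ground by (fastforce intro: variant.void_Exists)
next
  case (rename_Forall y \<phi> x)
  then have "y \<notin> fv (fsubst (\<sigma>(x := Var x)) \<phi>)"
    using fv_fsubst_partial_ground partial_ground_upd by blast
  then show ?case using rename_Forall
    by (simp add: fsubst_rename variant.rename_Forall free_for_fsubst_partial_ground)
next
  case (rename_Exists y \<phi> x)
  then have "y \<notin> fv (fsubst (\<sigma>(x := Var x)) \<phi>)"
    using fv_fsubst_partial_ground partial_ground_upd by blast
  then show ?case using rename_Exists
    by (simp add: fsubst_rename variant.rename_Exists free_for_fsubst_partial_ground)
qed (auto intro: variant.intros)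

lemma wf_tsubst: "wf_tm \<Theta> (tsubst \<sigma> t) \<longleftrightarrow> wf_tm \<Theta> t \<and> (\<forall>x\<in>fv_tm t. wf_tm \<Theta> (\<sigma> x))"
  by (induction t) auto

text \<open>Read from right to left this makes ground instances well-formed; read from left to right
  it recovers the well-formedness of a substituted term, provided its variable occurs free.\<close>

lemma wf_fsubst: "wf_fm \<Theta> (fsubst \<sigma> \<phi>) \<longleftrightarrow> wf_fm \<Theta> \<phi> \<and> (\<forall>x\<in>fv \<phi>. wf_tm \<Theta> (\<sigma> x))"
proof (induction \<phi> arbitrary: \<sigma>)
  case (Atom p ts)
  then show ?case by (auto simp: wf_tsubst)
qed auto

section \<open>Extending the set of constants\<close>

lemma fv_tm_map [simp]: "fv_tm (map_tm f g t) = fv_tm t"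
  by (induction t) auto

lemma fv_map [simp]: "fv (map_fm f g h \<phi>) = fv \<phi>"
  by (induction \<phi>) auto

lemma free_for_map [simp]: "free_for (map_tm f g t) x (map_fm f g h \<phi>) \<longleftrightarrow> free_for t x \<phi>"
  by (induction \<phi>) auto

lemma map_tsubst: "map_tm f g (tsubst \<sigma> t) = tsubst (\<lambda>x. map_tm f g (\<sigma> x)) (map_tm f g t)"
  by (induction t) auto

lemma map_fsubst: "map_fm f g h (fsubst \<sigma> \<phi>) = fsubst (\<lambda>x. map_tm f g (\<sigma> x)) (map_fm f g h \<phi>)"
proof (induction \<phi> arbitrary: \<sigma>)
  case (Atom p ts)
  show ?case by (simp add: map_tsubst)
next
  case (Forall y \<phi>)
  have "(\<lambda>x. map_tm f g ((\<sigma>(y := Var y)) x)) = (\<lambda>x. map_tm f g (\<sigma> x))(y := Var y)" by auto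
  then show ?case using Forall by simp
next
  case (Exists y \<phi>)
  have "(\<lambda>x. map_tm f g ((\<sigma>(y := Var y)) x)) = (\<lambda>x. map_tm f g (\<sigma> x))(y := Var y)" by auto
  then show ?case using Exists by simp
qed simp_all

lemma map_subst1: "map_fm f g h (\<phi>\<langle>x := t\<rangle>) = (map_fm f g h \<phi>)\<langle>x := map_tm f g t\<rangle>"
proof -
  have "(\<lambda>y. map_tm f g ((Var(x := t)) y)) = Var(x := map_tm f g t)" by auto
  then show ?thesis by (simp add: subst1_def map_fsubst)
qed

lemma variant_map: "variant \<phi> \<psi> \<Longrightarrow> variant (map_fm f g h \<phi>) (map_fm f g h \<psi>)"
proof (induction rule: variant.induct)
  case (rename_Forall y \<phi> x)
  then show ?case using free_for_map [of f g "Var y" x h \<phi>]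
    by (simp add: map_subst1 variant.rename_Forall)
next
  case (rename_Exists y \<phi> x)
  then show ?case using free_for_map [of f g "Var y" x h \<phi>]
    by (simp add: map_subst1 variant.rename_Exists)
qed (auto intro: variant.intros)

text \<open>Every schema is closed under a change of symbols, so an axiom over \<Theta> becomes an
  axiom of the diagram language, where validity is proved.\<close>

lemma QmbC_axiom_map: "QmbC_axiom \<phi> \<Longrightarrow> QmbC_axiom (map_fm f g h \<phi>)"
  by (induction rule: QmbC_axiom.induct)
    (auto simp: map_subst1 intro: QmbC_axiom.intros variant_map)

lemma lift_fm_simps [simp]:
  "lift_fm (Imp \<phi> \<psi>) = Imp (lift_fm \<phi>) (lift_fm \<psi>)"
  "lift_fm (Forall x \<phi>) = Forall x (lift_fm \<phi>)"
  "lift_fm (Exists x \<phi>) = Exists x (lift_fm \<phi>)"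
  "fv (lift_fm \<phi>) = fv \<phi>"
  by (simp_all add: lift_fm_def)

lemma wf_tm_lift: "wf_tm \<Theta> t \<Longrightarrow> wf_tm (diag_sig \<Theta> U) (map_tm Inl (\<lambda>f. f) t)"
  by (induction t) (auto simp: diag_sig_def)

lemma wf_lift_fm: "wf_fm \<Theta> \<phi> \<Longrightarrow> wf_fm (diag_sig \<Theta> U) (lift_fm \<phi>)"
  unfolding lift_fm_def
proof (induction \<phi>)
  case (Atom p ts)
  then show ?case by (auto simp: wf_tm_lift) (simp add: diag_sig_def)
qed auto

text \<open>The rules only regroup parts of well-formed premises. This supplies well-formedness of
  the formula that \<open>MP\<close> cuts away, which is no longer visible in the
  conclusion.\<close>

lemma derivable_wf: "QmbC_derivable \<Theta> \<Gamma> \<phi> \<Longrightarrow> wf_fm \<Theta> \<phi>"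
  by (induction rule: QmbC_derivable.induct) (auto simp: For_def)

section \<open>Grounding\<close>

lemma partial_ground_name [simp]: "partial_ground (\<lambda>x. name (\<mu> x))"
  by (simp add: partial_ground_def name_def)

lemma fv_ground [simp]: "fv (ground \<mu> \<phi>) = {}"
proof -
  \<comment> \<open>Generalised to an arbitrary bound \<open>V\<close>: a quantifier resets its
    variable, so the induction hypothesis is used with \<open>insert y V\<close>.\<close>
  have "fv (fsubst \<sigma> \<phi>) \<subseteq> V" if "\<And>x. fv_tm (\<sigma> x) \<subseteq> V" for \<sigma> V
    using that
  proof (induction \<phi> arbitrary: \<sigma> V)
    case (Atom p ts)
    then show ?case by (simp add: fv_tsubst UN_subset_iff)
  next
    case (Forall y \<phi>)
    have "fv (fsubst (\<sigma>(y := Var y)) \<phi>) \<subseteq> insert y V"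
      by (rule Forall.IH) (use Forall.prems in auto)
    then show ?case by auto
  next
    case (Exists y \<phi>)
    have "fv (fsubst (\<sigma>(y := Var y)) \<phi>) \<subseteq> insert y V"
      by (rule Exists.IH) (use Exists.prems in auto)
    then show ?case by auto
  qed simp_all
  from this [of "\<lambda>x. name (\<mu> x)" "{}"] show ?thesis by (simp add: ground_def name_def)
qed

lemma ground_simps [simp]:
  "ground \<mu> (And \<phi> \<psi>) = And (ground \<mu> \<phi>) (ground \<mu> \<psi>)"
  "ground \<mu> (Or \<phi> \<psi>) = Or (ground \<mu> \<phi>) (ground \<mu> \<psi>)"
  "ground \<mu> (Imp \<phi> \<psi>) = Imp (ground \<mu> \<phi>) (ground \<mu> \<psi>)"
  "ground \<mu> (Neg \<phi>) = Neg (ground \<mu> \<phi>)"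
  "ground \<mu> (Circ \<phi>) = Circ (ground \<mu> \<phi>)"
  by (simp_all add: ground_def)

lemma ground_quant:
  "ground \<mu> (Forall x \<phi>) = Forall x (fsubst ((\<lambda>y. name (\<mu> y))(x := Var x)) \<phi>)"
  "ground \<mu> (Exists x \<phi>) = Exists x (fsubst ((\<lambda>y. name (\<mu> y))(x := Var x)) \<phi>)"
  by (simp_all only: ground_def fsubst.simps)

lemma fv_tm_name: "fv_tm (name a) = {}"
  by (simp add: name_def)

lemma ground_fresh: "x \<notin> fv \<phi> \<Longrightarrow> ground (\<mu>(x := a)) \<phi> = ground \<mu> \<phi>"
  unfolding ground_def by (intro fsubst_cong) auto

text \<open>A name is closed, hence free for every variable, and grounding leaves it alone.\<close>

lemma ground_subst1_name: "ground \<mu> (\<phi>\<langle>x := name a\<rangle>) = ground (\<mu>(x := a)) \<phi>"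
proof -
  have "ground \<mu> (\<phi>\<langle>x := name a\<rangle>) = fsubst ((\<lambda>y. name (\<mu> y))(x := name a)) \<phi>"
    by (simp only: ground_def fsubst_subst1 free_for_closed tsubst_closed fv_tm_name)
  also have "\<dots> = ground (\<mu>(x := a)) \<phi>"
    unfolding ground_def by (intro fsubst_cong) simp
  finally show ?thesis .
qed

text \<open>The left side is the instance that \<open>val_Forall\<close> and
  \<open>val_Exists\<close> yield for a grounded quantified formula; it is traded for a changed
  assignment.\<close>

lemma subst1_name_ground_body:
  "(fsubst ((\<lambda>y. name (\<mu> y))(x := Var x)) \<phi>)\<langle>x := name a\<rangle> = ground (\<mu>(x := a)) \<phi>"
proof -
  have "(fsubst ((\<lambda>y. name (\<mu> y))(x := Var x)) \<phi>)\<langle>x := name a\<rangle> =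
      fsubst (\<lambda>z. tsubst (Var(x := name a)) (((\<lambda>y. name (\<mu> y))(x := Var x)) z)) \<phi>"
    unfolding subst1_def by (rule fsubst_fsubst_partial_ground) simp
  also have "\<dots> = ground (\<mu>(x := a)) \<phi>"
    unfolding ground_def by (intro fsubst_cong) (simp add: name_def)
  finally show ?thesis .
qed

section \<open>Values of terms\<close>

lemma tm_val_tsubst: "tm_val \<AA> \<mu> (tsubst \<sigma> t) = tm_val \<AA> (\<lambda>x. tm_val \<AA> \<mu> (\<sigma> x)) t"
  by (induction t) (auto simp: comp_def cong: map_cong)

lemma tm_val_cong: "(\<And>x. x \<in> fv_tm t \<Longrightarrow> \<mu> x = \<nu> x) \<Longrightarrow> tm_val \<AA> \<mu> t = tm_val \<AA> \<nu> t"
proof (induction t)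
  case (App f ts)
  then have "map (tm_val \<AA> \<mu>) ts = map (tm_val \<AA> \<nu>) ts" by auto
  then show ?case by (simp only: tm_val.simps)
qed auto

lemma tm_val_name [simp]: "tm_val (diag_interp \<AA>) \<mu> (name a) = a"
  by (simp add: diag_interp_def name_def)

lemma assignments_upd [simp]: "\<mu> \<in> assignments \<AA> \<Longrightarrow> a \<in> univ \<AA> \<Longrightarrow> \<mu>(x := a) \<in> assignments \<AA>"
  by (simp add: assignments_def)

section \<open>Soundness\<close>

lemma imp_eq_top_iff: "sup (- x) y = top \<longleftrightarrow> x \<le> (y :: 'a :: boolean_algebra)"
  by (metis compl_le_swap1 double_compl shunt1 sup_commute top_unique inf_top_right inf_top_left)

text \<open>The algebra of \<open>A2\<close>; both sides in fact equal the join of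
  \<open>- a\<close>, \<open>- b\<close> and \<open>c\<close>.\<close>

lemma imp_frege:
  fixes a b c :: "'a :: boolean_algebra"
  shows "sup (- a) (sup (- b) c) \<le> sup (- sup (- a) b) (sup (- a) c)"
proof -
  \<comment> \<open>The first complement is the meet of \<open>a\<close> and \<open>- b\<close>;
    joining it with \<open>- a\<close> absorbs \<open>a\<close>.\<close>
  have "sup (- sup (- a) b) (- a) = sup (- b) (- a)"
    by (simp add: sup_inf_distrib2)
  then have "sup (- sup (- a) b) (sup (- a) c) = sup (sup (- b) (- a)) c"
    by (simp only: flip: sup_assoc)
  then show ?thesis by (simp only: ac_simps order_refl)
qed

text \<open>The algebra of \<open>A8\<close>: by distributivity the right side is the join of
  \<open>- a\<close>, \<open>b\<close> and \<open>c\<close>.\<close>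

lemma imp_or:
  fixes a b c :: "'a :: boolean_algebra"
  shows "sup (- a) c \<le> sup (- sup (- b) c) (sup (- sup a b) c)"
  by (simp add: sup_inf_distrib1 sup_inf_distrib2 ac_simps)

section \<open>Values in a fixed model\<close>

locale QmbC_model = swap_structure \<B> + fo_structure \<Theta> \<B> \<AA> + QmbC_valuation \<Theta> \<B> \<AA> v
  for \<Theta> :: "('c, 'f, 'p) signature"
    and \<B> :: "'a::{boolean_algebra, complete_lattice} multialgebra"
    and \<AA> :: "('c, 'f, 'p, 'u, 'a) interp"
    and v :: "('c + 'u, 'f, 'p) fm \<Rightarrow> 'a triple"
begin

abbreviation "\<Theta>U \<equiv> diag_sig \<Theta> (univ \<AA>)"

text \<open>The multioperations prescribe only the first coordinate of a result, and designation
  reads that coordinate alone.\<close>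

abbreviation val1 :: "(var \<Rightarrow> 'u) \<Rightarrow> ('c + 'u, 'f, 'p) fm \<Rightarrow> 'a" where
  "val1 \<mu> \<phi> \<equiv> pr1 (v (ground \<mu> \<phi>))"

lemma wf_name: "a \<in> univ \<AA> \<Longrightarrow> wf_tm \<Theta>U (name a)"
  by (simp add: name_def diag_sig_def)

lemma ground_Sen: "\<mu> \<in> assignments \<AA> \<Longrightarrow> wf_fm \<Theta>U \<phi> \<Longrightarrow> ground \<mu> \<phi> \<in> Sen \<Theta>U"
proof -
  assume "\<mu> \<in> assignments \<AA>" and "wf_fm \<Theta>U \<phi>"
  then have "wf_fm \<Theta>U (ground \<mu> \<phi>)" by (simp add: ground_def wf_fsubst wf_name assignments_def)
  then show ?thesis by (simp add: Sen_def For_def)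
qed

lemma tm_val_univ: "\<mu> \<in> assignments \<AA> \<Longrightarrow> wf_tm \<Theta>U t \<Longrightarrow> tm_val (diag_interp \<AA>) \<mu> t \<in> univ \<AA>"
proof (induction t)
  case (App f ts)
  then show ?case using fI [of f "map (tm_val (diag_interp \<AA>) \<mu>) ts"]
    by (auto simp: diag_interp_def diag_sig_def)
qed (auto simp: assignments_def diag_interp_def diag_sig_def cI)

text \<open>Whole triples are compared, not first coordinates, as the premises of the substitution
  clauses demand. Multioperations do not determine the value of a compound from its parts, so only
  those clauses can pass equality upwards.\<close>

lemma val_subst:
  assumes "wf_fm \<Theta>U \<phi>" and t: "wf_tm \<Theta>U t" and "free_for t z \<phi>" and "\<mu> \<in> assignments \<AA>"
    and "b = tm_val (diag_interp \<AA>) \<mu> t"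
  shows "v (ground \<mu> (\<phi>\<langle>z := t\<rangle>)) = v (ground \<mu> (\<phi>\<langle>z := name b\<rangle>))"
  using assms(1,3-)
proof (induction \<phi> arbitrary: \<mu>)
  case (Atom p ts)
  have b: "b \<in> univ \<AA>" using Atom t tm_val_univ by simp
  \<comment> \<open>The value depends on \<open>s\<close> only through the value of
    \<open>s\<close>, which is \<open>b\<close> both for \<open>t\<close> and for
    \<open>name b\<close>.\<close>
  have val: "v (ground \<mu> ((Atom p ts)\<langle>z := s\<rangle>)) =
      pI \<AA> p (map (tm_val (diag_interp \<AA>) (\<mu>(z := tm_val (diag_interp \<AA>) \<mu> s))) ts)"
    if s: "wf_tm \<Theta>U s" for s
  proof -
    have "wf_fm \<Theta>U ((Atom p ts)\<langle>z := s\<rangle>)"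
      unfolding subst1_def wf_fsubst using Atom.prems(1) s by simp
    then have "ground \<mu> ((Atom p ts)\<langle>z := s\<rangle>) \<in> Sen \<Theta>U"
      using ground_Sen Atom.prems(3) by blast
    then have "Atom p (map (tsubst (\<lambda>x. name (\<mu> x))) (map (tsubst (Var(z := s))) ts)) \<in> Sen \<Theta>U"
      by (simp add: ground_def subst1_def)
    from val_Atom [OF this Atom.prems(3)] show ?thesis
      by (auto simp: ground_def subst1_def tm_val_tsubst intro!: arg_cong [of _ _ "pI \<AA> p"]
          tm_val_cong)
  qed
  show ?case using val [OF t] val [OF wf_name [OF b]] Atom.prems by simp
next
  case (Forall x \<phi>)
  show ?case
  \<comment> \<open>If \<open>z\<close> is not free, both substitutions leave the formula alone;
    otherwise \<open>free_for\<close> yields the side conditions of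
    \<open>subst_quant\<close>.\<close>
  proof (cases "z \<in> fv (Forall x \<phi>)")
    case True
    then have x: "x \<noteq> z" "x \<notin> fv_tm t" "free_for t z \<phi>" using Forall.prems by auto
    \<comment> \<open>As \<open>x\<close> does not occur in \<open>t\<close>, the same
      \<open>b\<close> serves every changed assignment, and the induction hypothesis applies to
      each.\<close>
    have "tm_val (diag_interp \<AA>) (\<mu>(x := a)) t = b" for a
      unfolding Forall.prems(4) by (rule tm_val_cong) (use x in auto)
    then have "\<forall>a\<in>univ \<AA>. v (ground (\<mu>(x := a)) (\<phi>\<langle>z := t\<rangle>)) =
        v (ground (\<mu>(x := a)) (\<phi>\<langle>z := name b\<rangle>))"
      using Forall x by auto
    then show ?thesis
      by (intro subst_quant [where Q = Forall]) (use x Forall.prems t in \<open>auto simp: For_def Ter_def\<close>)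
  qed (simp only: subst1_fresh not_False_eq_True)
next
  case (Exists x \<phi>)
  show ?case
  proof (cases "z \<in> fv (Exists x \<phi>)")
    case True
    then have x: "x \<noteq> z" "x \<notin> fv_tm t" "free_for t z \<phi>" using Exists.prems by auto
    have "tm_val (diag_interp \<AA>) (\<mu>(x := a)) t = b" for a
      unfolding Exists.prems(4) by (rule tm_val_cong) (use x in auto)
    then have "\<forall>a\<in>univ \<AA>. v (ground (\<mu>(x := a)) (\<phi>\<langle>z := t\<rangle>)) =
        v (ground (\<mu>(x := a)) (\<phi>\<langle>z := name b\<rangle>))"
      using Exists x by auto
    then show ?thesis
      by (intro subst_quant [where Q = Exists]) (use x Exists.prems t in \<open>auto simp: For_def Ter_def\<close>)
  qed (simp only: subst1_fresh not_False_eq_True)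
next
  case (And \<phi> \<psi>)
  show ?case by (rule subst_binary [where h = And]) (use And t in \<open>auto simp: For_def Ter_def\<close>)
next
  case (Or \<phi> \<psi>)
  show ?case by (rule subst_binary [where h = Or]) (use Or t in \<open>auto simp: For_def Ter_def\<close>)
next
  case (Imp \<phi> \<psi>)
  show ?case by (rule subst_binary [where h = Imp]) (use Imp t in \<open>auto simp: For_def Ter_def\<close>)
next
  case (Neg \<phi>)
  show ?case by (rule subst_unary [where h = Neg]) (use Neg t in \<open>auto simp: For_def Ter_def\<close>)
next
  case (Circ \<phi>)
  show ?case by (rule subst_unary [where h = Circ]) (use Circ t in \<open>auto simp: For_def Ter_def\<close>)
qed

section \<open>First coordinates under a fixed assignment\<close>

context
  fixes \<mu> assumes \<mu>: "\<mu> \<in> assignments \<AA>"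
begin

lemma val_in: "wf_fm \<Theta>U \<phi> \<Longrightarrow> v (ground \<mu> \<phi>) \<in> elems \<B>"
  using ground_Sen \<mu> val_elems by blast

lemma val1_And: "wf_fm \<Theta>U \<phi> \<Longrightarrow> wf_fm \<Theta>U \<psi> \<Longrightarrow> val1 \<mu> (And \<phi> \<psi>) = inf (val1 \<mu> \<phi>) (val1 \<mu> \<psi>)"
  using val_And [OF ground_Sen ground_Sen] m_and [OF val_in val_in] \<mu> by fastforce

lemma val1_Or: "wf_fm \<Theta>U \<phi> \<Longrightarrow> wf_fm \<Theta>U \<psi> \<Longrightarrow> val1 \<mu> (Or \<phi> \<psi>) = sup (val1 \<mu> \<phi>) (val1 \<mu> \<psi>)"
  using val_Or [OF ground_Sen ground_Sen] m_or [OF val_in val_in] \<mu> by fastforce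

lemma val1_Imp: "wf_fm \<Theta>U \<phi> \<Longrightarrow> wf_fm \<Theta>U \<psi> \<Longrightarrow> val1 \<mu> (Imp \<phi> \<psi>) = sup (- val1 \<mu> \<phi>) (val1 \<mu> \<psi>)"
  using val_Imp [OF ground_Sen ground_Sen] m_imp [OF val_in val_in] \<mu> by fastforce

lemma val1_Neg: "wf_fm \<Theta>U \<phi> \<Longrightarrow> val1 \<mu> (Neg \<phi>) = pr2 (v (ground \<mu> \<phi>))"
  using val_Neg [OF ground_Sen] m_neg [OF val_in] \<mu> by fastforce

lemma val1_Circ: "wf_fm \<Theta>U \<phi> \<Longrightarrow> val1 \<mu> (Circ \<phi>) = pr3 (v (ground \<mu> \<phi>))"
  using val_Circ [OF ground_Sen] m_circ [OF val_in] \<mu> by fastforce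

lemma val1_Forall:
  assumes "wf_fm \<Theta>U \<phi>"
  shows "val1 \<mu> (Forall x \<phi>) = (INF a\<in>univ \<AA>. val1 (\<mu>(x := a)) \<phi>)"
proof -
  have "ground \<mu> (Forall x \<phi>) \<in> Sen \<Theta>U" using ground_Sen \<mu> assms by simp
  then show ?thesis by (simp only: ground_quant val_Forall subst1_name_ground_body)
qed

lemma val1_Exists:
  assumes "wf_fm \<Theta>U \<phi>"
  shows "val1 \<mu> (Exists x \<phi>) = (SUP a\<in>univ \<AA>. val1 (\<mu>(x := a)) \<phi>)"
proof -
  have "ground \<mu> (Exists x \<phi>) \<in> Sen \<Theta>U" using ground_Sen \<mu> assms by simp
  then show ?thesis by (simp only: ground_quant val_Exists subst1_name_ground_body)
qed

lemma val1_Imp_top: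
  "wf_fm \<Theta>U \<phi> \<Longrightarrow> wf_fm \<Theta>U \<psi> \<Longrightarrow> val1 \<mu> (Imp \<phi> \<psi>) = top \<longleftrightarrow> val1 \<mu> \<phi> \<le> val1 \<mu> \<psi>"
  by (simp only: val1_Imp imp_eq_top_iff)

text \<open>If \<open>x\<close> is not free in \<open>\<phi>\<close>, then \<open>t\<close> may be ill-formed, and any individual is a witness.\<close>

lemma val1_subst_instance:
  assumes "wf_fm \<Theta>U (\<phi>\<langle>x := t\<rangle>)" and "free_for t x \<phi>"
  obtains a where "a \<in> univ \<AA>" and "val1 \<mu> (\<phi>\<langle>x := t\<rangle>) = val1 (\<mu>(x := a)) \<phi>"
proof (cases "x \<in> fv \<phi>")
  case True
  \<comment> \<open>Since \<open>x\<close> is free, \<open>t\<close> occurs in the instance and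
    inherits its well-formedness; the witness is the value of \<open>t\<close>.\<close>
  with assms(1) have "wf_fm \<Theta>U \<phi>" "wf_tm \<Theta>U t" by (auto simp: subst1_def wf_fsubst)
  then have "tm_val (diag_interp \<AA>) \<mu> t \<in> univ \<AA>"
    and "v (ground \<mu> (\<phi>\<langle>x := t\<rangle>)) = v (ground (\<mu>(x := tm_val (diag_interp \<AA>) \<mu> t)) \<phi>)"
    using tm_val_univ val_subst assms(2) \<mu> by (auto simp: ground_subst1_name)
  then show ?thesis using that by simp
next
  case False
  \<comment> \<open>Choosing \<open>\<mu> x\<close> makes the changed assignment equal to \<mu>
    itself.\<close>
  moreover have "\<mu> x \<in> univ \<AA>" using \<mu> by (simp add: assignments_def)
  ultimately show ?thesis using that by (simp add: subst1_fresh)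
qed

text \<open>Negation and \<open>Circ\<close> read off the second and third coordinates, so these are
  the defining equations of \<open>swap_universe\<close>. They validate \<open>A10\<close> and
  \<open>A11\<close>.\<close>

lemma val_universe:
  assumes "wf_fm \<Theta>U \<phi>"
  shows "sup (val1 \<mu> \<phi>) (val1 \<mu> (Neg \<phi>)) = top"
    and "inf (val1 \<mu> \<phi>) (inf (val1 \<mu> (Neg \<phi>)) (val1 \<mu> (Circ \<phi>))) = bot"
proof -
  have "v (ground \<mu> \<phi>) \<in> swap_universe" using val_in assms elems_subset by blast
  then show "sup (val1 \<mu> \<phi>) (val1 \<mu> (Neg \<phi>)) = top"
    and "inf (val1 \<mu> \<phi>) (inf (val1 \<mu> (Neg \<phi>)) (val1 \<mu> (Circ \<phi>))) = bot"
    using assms by (simp_all only: val1_Neg val1_Circ) (simp_all add: swap_universe_def inf_assoc)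
qed

lemma axiom_valid:
  assumes "QmbC_axiom \<phi>" and "wf_fm \<Theta>U \<phi>"
  shows "val1 \<mu> \<phi> = top"
  using assms
proof (induction rule: QmbC_axiom.induct)
  case (A11 \<alpha> \<beta>)
  \<comment> \<open>Residuation turns the nested implications into the meet of their premises lying
    below \<beta>; that meet is bottom.\<close>
  then have "inf (val1 \<mu> (Circ \<alpha>)) (inf (val1 \<mu> \<alpha>) (val1 \<mu> (Neg \<alpha>))) = bot"
    using val_universe(2) [of \<alpha>] by (simp add: ac_simps)
  then have "inf (val1 \<mu> (Circ \<alpha>)) (inf (val1 \<mu> \<alpha>) (val1 \<mu> (Neg \<alpha>))) \<le> val1 \<mu> \<beta>"
    by simp
  with A11 show ?case
    by (simp add: val1_Imp imp_eq_top_iff shunt1 sup_assoc del: ground_simps)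
next
  case (A10 \<alpha>)
  then show ?case using val_universe(1) [of \<alpha>] by (simp add: val1_Or del: ground_simps)
next
  case (Ax12 t x \<phi>)
  then have "wf_fm \<Theta>U (\<phi>\<langle>x := t\<rangle>)" and wf: "wf_fm \<Theta>U \<phi>" by auto
  with Ax12 obtain a where "a \<in> univ \<AA>" "val1 \<mu> (\<phi>\<langle>x := t\<rangle>) = val1 (\<mu>(x := a)) \<phi>"
    using val1_subst_instance by blast
  \<comment> \<open>The instance is a member of the family whose supremum is the existential value;
    \<open>Ax13\<close> is dual.\<close>
  with wf have "val1 \<mu> (\<phi>\<langle>x := t\<rangle>) \<le> val1 \<mu> (Exists x \<phi>)"
    by (simp only: val1_Exists) (rule SUP_upper2, auto)
  then show ?case using Ax12 by (simp add: val1_Imp_top del: ground_simps)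
next
  case (Ax13 t x \<phi>)
  then have "wf_fm \<Theta>U (\<phi>\<langle>x := t\<rangle>)" and wf: "wf_fm \<Theta>U \<phi>" by auto
  with Ax13 obtain a where "a \<in> univ \<AA>" "val1 \<mu> (\<phi>\<langle>x := t\<rangle>) = val1 (\<mu>(x := a)) \<phi>"
    using val1_subst_instance by blast
  with wf have "val1 \<mu> (Forall x \<phi>) \<le> val1 \<mu> (\<phi>\<langle>x := t\<rangle>)"
    by (simp only: val1_Forall) (rule INF_lower2, auto)
  then show ?case using Ax13 by (simp add: val1_Imp_top del: ground_simps)
next
  case (Ax14 \<alpha> \<beta>)
  \<comment> \<open>Grounding first makes both sides sentences, so that \<open>val_variant\<close>
    applies.\<close>
  then have "variant (ground \<mu> \<alpha>) (ground \<mu> \<beta>)"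
    unfolding ground_def by (intro variant_fsubst) auto
  then have "v (ground \<mu> \<alpha>) = v (ground \<mu> \<beta>)"
    using Ax14 ground_Sen \<mu> val_variant by simp
  then show ?case using Ax14 by (simp add: val1_Imp_top del: ground_simps)
next
  case (A2 \<alpha> \<beta> \<gamma>)
  then show ?case by (simp only: wf_fm.simps val1_Imp imp_eq_top_iff imp_frege)
next
  case (A8 \<alpha> \<gamma> \<beta>)
  then show ?case by (simp only: wf_fm.simps val1_Imp val1_Or imp_eq_top_iff imp_or)
next
  case (A3 \<alpha> \<beta>)
  then show ?case
    by (simp add: val1_Imp val1_And imp_eq_top_iff sup_inf_distrib1 del: ground_simps)
qed (simp_all add: val1_Imp val1_And val1_Or imp_eq_top_iff shunt1 ac_simps del: ground_simps)

end

text \<open>The induction keeps \<mu> arbitrary, because the quantifier rules use their premise at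
  every \<open>\<mu>(x := a)\<close>; hence the hypotheses are required at all assignments
  too.\<close>

lemma soundness:
  assumes "QmbC_derivable \<Theta> \<Gamma> \<phi>"
    and hyps: "\<And>\<gamma> \<mu>. \<gamma> \<in> \<Gamma> \<Longrightarrow> \<mu> \<in> assignments \<AA> \<Longrightarrow> val1 \<mu> (lift_fm \<gamma>) = top"
    and "\<mu> \<in> assignments \<AA>"
  shows "val1 \<mu> (lift_fm \<phi>) = top"
  using assms(1,3)
proof (induction arbitrary: \<mu> rule: QmbC_derivable.induct)
  case (ax \<phi>)
  then have "QmbC_axiom (lift_fm \<phi>)" and "wf_fm \<Theta>U (lift_fm \<phi>)"
    using QmbC_axiom_map wf_lift_fm by (auto simp: For_def lift_fm_def)
  then show ?case using axiom_valid ax.prems by blast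
next
  case (hyp \<phi>)
  then show ?case using hyps by simp
next
  case (MP \<alpha> \<beta>)
  have wf: "wf_fm \<Theta>U (lift_fm \<alpha>)" "wf_fm \<Theta>U (lift_fm \<beta>)"
    using derivable_wf [OF MP.hyps(2)] wf_lift_fm by auto
  have "val1 \<mu> (Imp (lift_fm \<alpha>) (lift_fm \<beta>)) = top"
    using MP.IH(2) MP.prems by (simp only: lift_fm_simps)
  then have "val1 \<mu> (lift_fm \<alpha>) \<le> val1 \<mu> (lift_fm \<beta>)"
    using val1_Imp_top wf MP.prems by blast
  then show ?case using MP.IH(1) MP.prems by (simp add: top_unique)
next
  case (Exists_In \<phi> \<psi> x)
  have wf: "wf_fm \<Theta>U (lift_fm \<phi>)" "wf_fm \<Theta>U (lift_fm \<psi>)"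
    using derivable_wf [OF Exists_In.hyps(1)] wf_lift_fm by auto
  \<comment> \<open>As \<open>x\<close> is not free in \<psi>, the right side does not vary with
    \<open>a\<close>: it is an upper bound of the family whose supremum is the existential
    value.\<close>
  have "val1 (\<mu>(x := a)) (lift_fm \<phi>) \<le> val1 \<mu> (lift_fm \<psi>)" if "a \<in> univ \<AA>" for a
  proof -
    have a: "\<mu>(x := a) \<in> assignments \<AA>" using that Exists_In.prems by simp
    have "val1 (\<mu>(x := a)) (Imp (lift_fm \<phi>) (lift_fm \<psi>)) = top"
      using Exists_In.IH [OF a] by (simp only: lift_fm_simps)
    then have "val1 (\<mu>(x := a)) (lift_fm \<phi>) \<le> val1 (\<mu>(x := a)) (lift_fm \<psi>)"
      using val1_Imp_top [OF a] wf by blast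
    moreover have "x \<notin> fv (lift_fm \<psi>)" using Exists_In.hyps by simp
    ultimately show ?thesis by (simp add: ground_fresh)
  qed
  then have "val1 \<mu> (Exists x (lift_fm \<phi>)) \<le> val1 \<mu> (lift_fm \<psi>)"
    using wf Exists_In.prems by (simp add: val1_Exists SUP_le_iff)
  then have "val1 \<mu> (Imp (Exists x (lift_fm \<phi>)) (lift_fm \<psi>)) = top"
    using val1_Imp_top [OF Exists_In.prems] wf by simp
  then show ?case by (simp only: lift_fm_simps)
next
  case (Forall_In \<phi> \<psi> x)
  have wf: "wf_fm \<Theta>U (lift_fm \<phi>)" "wf_fm \<Theta>U (lift_fm \<psi>)"
    using derivable_wf [OF Forall_In.hyps(1)] wf_lift_fm by auto
  \<comment> \<open>Dually, the value of \<phi> does not vary with \<open>a\<close> and is a lower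
    bound of the family.\<close>
  have "val1 \<mu> (lift_fm \<phi>) \<le> val1 (\<mu>(x := a)) (lift_fm \<psi>)" if "a \<in> univ \<AA>" for a
  proof -
    have a: "\<mu>(x := a) \<in> assignments \<AA>" using that Forall_In.prems by simp
    have "val1 (\<mu>(x := a)) (Imp (lift_fm \<phi>) (lift_fm \<psi>)) = top"
      using Forall_In.IH [OF a] by (simp only: lift_fm_simps)
    then have "val1 (\<mu>(x := a)) (lift_fm \<phi>) \<le> val1 (\<mu>(x := a)) (lift_fm \<psi>)"
      using val1_Imp_top [OF a] wf by blast
    moreover have "x \<notin> fv (lift_fm \<phi>)" using Forall_In.hyps by simp
    ultimately show ?thesis by (simp add: ground_fresh)
  qed
  then have "val1 \<mu> (lift_fm \<phi>) \<le> val1 \<mu> (Forall x (lift_fm \<psi>))"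
    using wf Forall_In.prems by (simp add: val1_Forall le_INF_iff)
  then have "val1 \<mu> (Imp (lift_fm \<phi>) (Forall x (lift_fm \<psi>))) = top"
    using val1_Imp_top [OF Forall_In.prems] wf by simp
  then show ?case by (simp only: lift_fm_simps)
qed

end

theorem theorem7p5:
  fixes \<Theta> :: "('c, 'f, 'p) signature"
    and \<Gamma> :: "('c, 'f, 'p) fm set"
    and \<phi> :: "('c, 'f, 'p) fm"
  assumes "fo_signature \<Theta>"
    and "\<Gamma> \<union> {\<phi>} \<subseteq> For \<Theta>"
    and "QmbC_derivable \<Theta> \<Gamma> \<phi>"
  shows "QmbC_entails TYPE('a::{boolean_algebra, complete_lattice}) TYPE('u) \<Theta> \<Gamma> \<phi>"
  unfolding QmbC_entails_def entails_in_def
proof (intro allI impI ballI)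
  fix \<B> :: "'a multialgebra" and \<AA> :: "('c, 'f, 'p, 'u, 'a) interp" and v \<mu>
  assume "swap_structure \<B>" "fo_structure \<Theta> \<B> \<AA>" "QmbC_valuation \<Theta> \<B> \<AA> v"
  then interpret QmbC_model \<Theta> \<B> \<AA> v by (simp add: QmbC_model_def)
  assume \<Gamma>: "\<forall>\<gamma>\<in>\<Gamma>. \<forall>\<mu>\<in>assignments \<AA>. val_at v \<mu> (lift_fm \<gamma>) \<in> designated \<B>"
    and \<mu>: "\<mu> \<in> assignments \<AA>"
  have "val1 \<mu> (lift_fm \<phi>) = top"
    using soundness [OF assms(3) _ \<mu>] \<Gamma> by (simp add: val_at_def designated_def)
  \<comment> \<open>Designation also asks for membership in the carrier, which holds because \<phi>
    is a formula over \<Theta>.\<close>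
  moreover have "v (ground \<mu> (lift_fm \<phi>)) \<in> elems \<B>"
    using assms(2) by (auto simp: For_def intro: val_in [OF \<mu>] wf_lift_fm)
  ultimately show "val_at v \<mu> (lift_fm \<phi>) \<in> designated \<B>"
    by (simp add: val_at_def designated_def)
qed

end
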